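(* Let $n\ge1$ and let $a_1<a_2<\dots<a_n$ be positive integers. Then $$\sum_{\pi\in\mathfrak{B}_{\{a_1,\dots,a_n\}}}(-1)^{\mathsf{inv}_B(\pi)}t^{\mathsf{des}_B(\pi)}s^{\mathsf{asc}_B(\pi)}u^{\mathsf{pos}_{a_n}(\pi)}=(s-t)^n u^n.$$
   Context: $\mathfrak{B}_{\{a_1,\dots,a_n\}}$ is the set of all bijections $\pi$ of $\{\pm a_1,\dots,\pm a_n\}$ with $\pi(-x)=-\pi(x)$ (so it has $2^nn!$ elements); write $\pi_{a_i}=\pi(a_i)$, and set $a_0=0$, $\pi_{a_0}=0$. Define $\mathsf{inv}_B(\pi)=|\{1\le i<j\le n:\pi_{a_i}>\pi_{a_j}\}|+|\{1\le i<j\le n:-\pi_{a_i}>\pi_{a_j}\}|+|\{i\in[n]:\pi_{a_i}<0\}|$, $\mathsf{des}_B(\pi)=|\{i\in\{0,\dots,n-1\}:\pi_{a_i}>\pi_{a_{i+1}}\}|$, $\mathsf{asc}_B(\pi)=|\{i\in\{0,\dots,n-1\}:\pi_{a_i}<\pi_{a_{i+1}}\}|$, and $\mathsf{pos}_{a_n}(\pi)=k$ where $|\pi_{a_k}|=a_n$. *)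

theory Defs
  imports Complex_Main "HOL-Combinatorics.Permutations"
begin

text \<open>
  A sequence \<open>a 1 < \<dots> < a n\<close> of positive integers is a function \<open>a :: nat \<Rightarrow> int\<close>
  of which only the values at \<open>1, \<dots>, n\<close> matter.  The convention \<open>\<pi>(a 0) = 0\<close> is built
  into \<open>signed_val\<close>, so the value \<open>a 0\<close> is never used.
\<close>

definition signed_letters :: "nat \<Rightarrow> (nat \<Rightarrow> int) \<Rightarrow> int set" where
  "signed_letters n a = a ` {1..n} \<union> (\<lambda>i. - a i) ` {1..n}"

text \<open>
  \<open>permutes\<close> makes \<open>\<pi>\<close> the identity outside \<open>signed_letters n a\<close>, so that every bijection
  of that set is represented by exactly one function.
\<close>

definition signed_perms :: "nat \<Rightarrow> (nat \<Rightarrow> int) \<Rightarrow> (int \<Rightarrow> int) set" where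
  "signed_perms n a =
     {\<pi>. \<pi> permutes signed_letters n a \<and> (\<forall>x\<in>signed_letters n a. \<pi> (- x) = - \<pi> x)}"

definition signed_val :: "(nat \<Rightarrow> int) \<Rightarrow> (int \<Rightarrow> int) \<Rightarrow> nat \<Rightarrow> int" where
  "signed_val a \<pi> i = (if i = 0 then 0 else \<pi> (a i))"

definition inv_B :: "nat \<Rightarrow> (nat \<Rightarrow> int) \<Rightarrow> (int \<Rightarrow> int) \<Rightarrow> nat" where
  "inv_B n a \<pi> =
     card {(i, j). 1 \<le> i \<and> i < j \<and> j \<le> n \<and> signed_val a \<pi> i > signed_val a \<pi> j}
   + card {(i, j). 1 \<le> i \<and> i < j \<and> j \<le> n \<and> - signed_val a \<pi> i > signed_val a \<pi> j}
   + card {i \<in> {1..n}. signed_val a \<pi> i < 0}"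

definition des_B :: "nat \<Rightarrow> (nat \<Rightarrow> int) \<Rightarrow> (int \<Rightarrow> int) \<Rightarrow> nat" where
  "des_B n a \<pi> = card {i \<in> {0..<n}. signed_val a \<pi> i > signed_val a \<pi> (i + 1)}"

definition asc_B :: "nat \<Rightarrow> (nat \<Rightarrow> int) \<Rightarrow> (int \<Rightarrow> int) \<Rightarrow> nat" where
  "asc_B n a \<pi> = card {i \<in> {0..<n}. signed_val a \<pi> i < signed_val a \<pi> (i + 1)}"

definition pos_last :: "nat \<Rightarrow> (nat \<Rightarrow> int) \<Rightarrow> (int \<Rightarrow> int) \<Rightarrow> nat" where
  "pos_last n a \<pi> = (THE k. k \<in> {1..n} \<and> \<bar>signed_val a \<pi> k\<bar> = a n)"

end

theory Submission imports Defs
begin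

text \<open>
  Modulo 2, \<open>inv_B\<close> is the number of inversions of the word of absolute values plus the number of
  negative letters.  Hence changing the sign of a single letter reverses the sign of a summand and
  keeps the position of \<open>a n\<close>.  If some position \<open>i\<close> does not carry the letter \<open>\<plusminus>a i\<close>, take the
  least such \<open>i\<close> and change the sign of the letter \<open>\<plusminus>a i\<close>: it stands to the right of position \<open>i\<close>,
  so its neighbours are larger in absolute value, and descents and ascents are kept.  What
  survives this involution are the \<open>2^n\<close> signed identities, in which \<open>i\<close> is a descent iff the
  letter at position \<open>i + 1\<close> is negative; they contribute \<open>(s - t)^n u^n\<close> by the binomial theorem.
\<close>

section \<open>Two general identities for finite sums in a commutative ring\<close>

lemma sum_sign_reversing_involution:
  fixes g :: "'a \<Rightarrow> 'r::comm_ring_1"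
  assumes "finite T"
    and "\<And>x. x \<in> T \<Longrightarrow> \<phi> x \<in> T" and "\<And>x. x \<in> T \<Longrightarrow> \<phi> (\<phi> x) = x"
    and "\<And>x. x \<in> T \<Longrightarrow> even (k (\<phi> x)) \<longleftrightarrow> odd (k x)"
    and "\<And>x. x \<in> T \<Longrightarrow> g (\<phi> x) = g x"
  shows "(\<Sum>x\<in>T. (- 1) ^ k x * g x) = 0"
proof -
  \<comment> \<open>Even and odd terms are matched by \<open>\<phi>\<close> instead of deriving
    \<open>S = - S\<close>: that would only give \<open>2 * S = 0\<close>, too weak in an arbitrary
    commutative ring.\<close>
  have odd_even: "(\<Sum>x\<in>{x\<in>T. odd (k x)}. g x) = (\<Sum>x\<in>{x\<in>T. even (k x)}. g x)"
    by (rule sum.reindex_bij_witness[of _ \<phi> \<phi>]) (use assms in auto)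
  have "(\<Sum>x\<in>T. (- 1) ^ k x * g x) = (\<Sum>x\<in>T. if even (k x) then g x else - g x)"
    by (rule sum.cong) auto
  also have "\<dots> = (\<Sum>x\<in>{x\<in>T. even (k x)}. g x) + (\<Sum>x\<in>{x\<in>T. odd (k x)}. - g x)"
    using assms(1) by (simp add: sum.If_cases Int_def)
  finally show ?thesis
    by (simp add: sum_negf odd_even)
qed

text \<open>Expand the product of \<open>card A\<close> factors \<open>x + y\<close>;
  \<open>N\<close> records the factors that contribute \<open>x\<close>. Later \<open>N\<close> is
  the set of positions with a negative letter.\<close>

lemma sum_Pow_binomial:
  fixes x y :: "'r::comm_ring_1"
  assumes "finite A"
  shows "(\<Sum>N\<in>Pow A. x ^ card N * y ^ (card A - card N)) = (x + y) ^ card A"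
proof -
  have "(x + y) ^ card A = (\<Prod>i\<in>A. x + y)"
    by simp
  also have "\<dots> = (\<Sum>N\<in>Pow A. (\<Prod>i\<in>N. x) * (\<Prod>i\<in>A - N. y))"
    using assms by (rule prod_add)
  also have "\<dots> = (\<Sum>N\<in>Pow A. x ^ card N * y ^ (card A - card N))"
    using assms by (intro sum.cong) (auto simp: card_Diff_subset finite_subset)
  finally show ?thesis
    by simp
qed

section \<open>Changing the sign of one letter\<close>

definition flip :: "int \<Rightarrow> int \<Rightarrow> int" where
  "flip c x = (if \<bar>x\<bar> = c then - x else x)"

lemma abs_flip [simp]: "\<bar>flip c x\<bar> = \<bar>x\<bar>"
  by (simp add: flip_def)

lemma flip_flip [simp]: "flip c (flip c x) = x"
  by (simp add: flip_def)

text \<open>If one of the two numbers is \<open>c\<close> or \<open>- c\<close>, the other is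
  farther from 0, so the sign of that other number alone decides the comparison.\<close>

lemma flip_less_flip_iff:
  assumes "\<bar>x\<bar> = c \<Longrightarrow> \<bar>y\<bar> > c" and "\<bar>y\<bar> = c \<Longrightarrow> \<bar>x\<bar> > c"
  shows "flip c x < flip c y \<longleftrightarrow> x < y"
  using assms unfolding flip_def by (auto split: if_splits)

section \<open>Absolute values of the letters of a signed permutation\<close>

locale signed_alphabet =
  fixes n :: nat and a :: "nat \<Rightarrow> int"
  assumes pos: "\<And>i. i \<in> {1..n} \<Longrightarrow> a i > 0"
    and mono: "strict_mono_on {1..n} a"
begin

lemma less_iff: "i \<in> {1..n} \<Longrightarrow> j \<in> {1..n} \<Longrightarrow> a i < a j \<longleftrightarrow> i < j"
  using mono by (simp add: strict_mono_on_less)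

lemma eq_iff: "i \<in> {1..n} \<Longrightarrow> j \<in> {1..n} \<Longrightarrow> a i = a j \<longleftrightarrow> i = j"
  using mono by (metis less_iff less_irrefl linorder_neqE_nat)

lemma signed_letters_iff: "x \<in> signed_letters n a \<longleftrightarrow> \<bar>x\<bar> \<in> a ` {1..n}"
proof
  assume "x \<in> signed_letters n a"
  then show "\<bar>x\<bar> \<in> a ` {1..n}"
    unfolding signed_letters_def using pos by (fastforce simp: abs_if)
next
  assume "\<bar>x\<bar> \<in> a ` {1..n}"
  then show "x \<in> signed_letters n a"
    unfolding signed_letters_def by (auto simp: abs_if image_iff split: if_splits)
      (metis add.inverse_inverse atLeastAtMost_iff)
qed

lemma finite_signed_perms: "finite (signed_perms n a)"
proof -
  have "finite (signed_letters n a)"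
    by (simp add: signed_letters_def)
  then have "finite {\<pi>. \<pi> permutes signed_letters n a}"
    by (rule finite_permutations)
  then show ?thesis
    by (rule rev_finite_subset) (auto simp: signed_perms_def)
qed

lemma signed_val_0 [simp]: "signed_val a \<pi> 0 = 0"
  by (simp add: signed_val_def)

lemma signed_permsD:
  assumes "\<pi> \<in> signed_perms n a"
  shows "\<pi> permutes signed_letters n a"
    and "\<And>x. x \<in> signed_letters n a \<Longrightarrow> \<pi> (- x) = - \<pi> x"
  using assms by (auto simp: signed_perms_def)

lemma abs_val_mem:
  assumes "\<pi> \<in> signed_perms n a" "i \<in> {1..n}"
  shows "\<bar>signed_val a \<pi> i\<bar> \<in> a ` {1..n}"
proof -
  have "a i \<in> signed_letters n a"
    using assms(2) by (auto simp: signed_letters_def)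
  then have "\<pi> (a i) \<in> signed_letters n a"
    using signed_permsD(1)[OF assms(1)] by (simp add: permutes_in_image)
  then show ?thesis
    using assms(2) by (simp add: signed_letters_iff signed_val_def)
qed

text \<open>Equal absolute values mean \<open>\<pi> (a i) = \<pi> (a j)\<close> or
  \<open>\<pi> (a i) = \<pi> (- a j)\<close>, because \<open>\<pi>\<close> is odd; injectivity and
  positivity of the \<open>a i\<close> leave only \<open>i = j\<close>.\<close>

lemma abs_val_eq_iff:
  assumes "\<pi> \<in> signed_perms n a" "i \<in> {1..n}" "j \<in> {1..n}"
  shows "\<bar>signed_val a \<pi> i\<bar> = \<bar>signed_val a \<pi> j\<bar> \<longleftrightarrow> i = j"
proof
  assume eq: "\<bar>signed_val a \<pi> i\<bar> = \<bar>signed_val a \<pi> j\<bar>"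
  have mem: "a j \<in> signed_letters n a"
    using assms(3) by (auto simp: signed_letters_def)
  have "\<pi> (a i) = \<pi> (a j) \<or> \<pi> (a i) = \<pi> (- a j)"
    using eq assms signed_permsD(2)[OF assms(1) mem] by (auto simp: signed_val_def abs_eq_iff)
  then have "a i = a j \<or> a i = - a j"
    using permutes_inj[OF signed_permsD(1)[OF assms(1)]] by (auto dest: injD)
  moreover have "a i \<noteq> - a j"
    using pos[OF assms(2)] pos[OF assms(3)] by linarith
  ultimately show "i = j"
    using eq_iff assms by blast
qed simp

text \<open>An injective map into a finite set of the same size is onto, so each letter occurs, up
  to sign, at some position.\<close>

lemma abs_val_image:
  assumes "\<pi> \<in> signed_perms n a"
  shows "(\<lambda>i. \<bar>signed_val a \<pi> i\<bar>) ` {1..n} = a ` {1..n}"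
proof (rule card_subset_eq)
  show "card ((\<lambda>i. \<bar>signed_val a \<pi> i\<bar>) ` {1..n}) = card (a ` {1..n})"
    using abs_val_eq_iff[OF assms] eq_iff by (simp add: card_image inj_on_def)
qed (use abs_val_mem[OF assms] in auto)

lemma abs_val_position:
  assumes "\<pi> \<in> signed_perms n a" "m \<in> {1..n}"
  obtains j where "j \<in> {1..n}" "\<bar>signed_val a \<pi> j\<bar> = a m"
proof -
  have "a m \<in> (\<lambda>i. \<bar>signed_val a \<pi> i\<bar>) ` {1..n}"
    using abs_val_image[OF assms(1)] assms(2) by simp
  then show ?thesis
    using that by auto
qed

section \<open>The parity of \<open>inv_B\<close> and its change under a flip\<close>

text \<open>For a pair with values x, y, exactly one of x > y and -x > y holds if \<bar>x\<bar> >
  \<bar>y\<bar>; if \<bar>x\<bar> < \<bar>y\<bar>, both hold or neither does, according to the sign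
  of y.\<close>

lemma even_inv_B_iff:
  assumes \<pi>: "\<pi> \<in> signed_perms n a"
  shows "even (inv_B n a \<pi>) \<longleftrightarrow>
    even (card {(i, j). 1 \<le> i \<and> i < j \<and> j \<le> n \<and> \<bar>signed_val a \<pi> i\<bar> > \<bar>signed_val a \<pi> j\<bar>}
      + card {i \<in> {1..n}. signed_val a \<pi> i < 0})"
proof -
  define w where "w = signed_val a \<pi>"
  let ?S = "\<lambda>P. {(i, j). 1 \<le> i \<and> i < j \<and> j \<le> n \<and> P (w i) (w j)}"
  let ?A = "?S (\<lambda>x y. x > y)" and ?B = "?S (\<lambda>x y. - x > y)"
    and ?C = "?S (\<lambda>x y. \<bar>x\<bar> > \<bar>y\<bar>)" and ?D = "?S (\<lambda>x y. \<bar>x\<bar> < \<bar>y\<bar> \<and> y < 0)"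
  have fin: "finite (?S P)" for P
    by (rule finite_subset[of _ "{1..n} \<times> {1..n}"]) auto
  have neq: "\<bar>w i\<bar> \<noteq> \<bar>w j\<bar>" if "1 \<le> i" "i < j" "j \<le> n" for i j
    using that abs_val_eq_iff[OF \<pi>, of i j] by (auto simp: w_def)
  have "w i > w j \<or> - w i > w j \<longleftrightarrow> \<bar>w i\<bar> > \<bar>w j\<bar> \<or> \<bar>w i\<bar> < \<bar>w j\<bar> \<and> w j < 0"
    if "1 \<le> i" "i < j" "j \<le> n" for i j
    using neq[OF that] by linarith
  then have "?A \<union> ?B = ?C \<union> ?D"
    by blast
  moreover have "w i > w j \<and> - w i > w j \<longleftrightarrow> \<bar>w i\<bar> < \<bar>w j\<bar> \<and> w j < 0" for i j
    by linarith
  then have "?A \<inter> ?B = ?D"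
    by blast
  moreover have "card (?C \<union> ?D) = card ?C + card ?D"
    by (rule card_Un_disjoint[OF fin fin]) auto
  \<comment> \<open>Counting union and intersection separately: the pairs in \<open>?D\<close> lie
    in both \<open>?A\<close> and \<open>?B\<close>, so they count twice and vanish modulo
    2.\<close>
  ultimately have "card ?A + card ?B = card ?C + 2 * card ?D"
    using card_Un_Int[OF fin fin, of "\<lambda>x y. x > y" "\<lambda>x y. - x > y"]
    by (simp only: mult_2 add.assoc)
  then show ?thesis
    by (simp add: inv_B_def w_def)
qed

lemma flip_comp_signed_perms:
  assumes \<pi>: "\<pi> \<in> signed_perms n a" and c: "c \<in> a ` {1..n}"
  shows "flip c \<circ> \<pi> \<in> signed_perms n a"
proof -
  have "flip c permutes signed_letters n a"
  proof (rule bij_imp_permutes)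
    show "bij_betw (flip c) (signed_letters n a) (signed_letters n a)"
      by (rule bij_betw_byWitness[where f' = "flip c"]) (auto simp: signed_letters_iff)
  qed (use c in \<open>auto simp: flip_def signed_letters_iff\<close>)
  then show ?thesis
    using signed_permsD[OF \<pi>] by (auto simp: signed_perms_def flip_def intro: permutes_compose)
qed

lemma signed_val_flip_comp:
  assumes "c > 0"
  shows "signed_val a (flip c \<circ> \<pi>) i = flip c (signed_val a \<pi> i)"
  using assms by (simp add: signed_val_def flip_def)

text \<open>The inversions among absolute values stay; the set of negative positions gains or loses
  exactly the position \<open>j\<close> of the flipped letter.\<close>

lemma inv_B_flip_comp:
  assumes \<pi>: "\<pi> \<in> signed_perms n a" and m: "m \<in> {1..n}"
  shows "even (inv_B n a (flip (a m) \<circ> \<pi>)) \<longleftrightarrow> odd (inv_B n a \<pi>)"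
proof -
  note val = signed_val_flip_comp[OF pos[OF m]]
  define w where "w = signed_val a \<pi>"
  let ?N = "{i \<in> {1..n}. w i < 0}" and ?N' = "{i \<in> {1..n}. flip (a m) (w i) < 0}"
  obtain j where j: "j \<in> {1..n}" "\<bar>w j\<bar> = a m"
    using abs_val_position[OF \<pi> m] w_def by blast
  have other: "flip (a m) (w i) = w i" if "i \<in> {1..n}" "i \<noteq> j" for i
    using that j abs_val_eq_iff[OF \<pi>, of i j] by (auto simp: flip_def w_def)
  have wj: "flip (a m) (w j) = - w j" "w j \<noteq> 0"
    using j pos[OF m] by (auto simp: flip_def)
  have neg: "flip (a m) (w i) < 0 \<longleftrightarrow> (if i = j then w i > 0 else w i < 0)" if "i \<in> {1..n}" for i
    using other[OF that] wj by auto
  have "even (card ?N') \<longleftrightarrow> odd (card ?N)"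
  proof (cases "w j < 0")
    case True
    then have "?N = insert j ?N'" "j \<notin> ?N'"
      using j(1) neg by (auto split: if_splits)
    then show ?thesis
      by simp
  next
    case False
    then have "?N' = insert j ?N" "j \<notin> ?N"
      using j(1) neg wj(2) by (auto split: if_splits)
    then show ?thesis
      by simp
  qed
  then show ?thesis
    by (auto simp: even_inv_B_iff[OF \<pi>] even_inv_B_iff[OF flip_comp_signed_perms[OF \<pi> imageI[OF m]]]
        val w_def)
qed

lemma pos_last_flip_comp:
  assumes "c > 0"
  shows "pos_last n a (flip c \<circ> \<pi>) = pos_last n a \<pi>"
  by (simp add: pos_last_def signed_val_flip_comp[OF assms])

section \<open>The least misplaced position and the neighbours of its letter\<close>

definition misplaced :: "(int \<Rightarrow> int) \<Rightarrow> nat \<Rightarrow> bool" where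
  "misplaced \<pi> i \<longleftrightarrow> i \<in> {1..n} \<and> \<bar>signed_val a \<pi> i\<bar> \<noteq> a i"

text \<open>The letters smaller than \<open>a m\<close> all sit at their own positions, left of
  \<open>m\<close>, so none of them is available from \<open>m\<close> on.\<close>

lemma abs_val_ge_misplaced:
  assumes \<pi>: "\<pi> \<in> signed_perms n a" and "misplaced \<pi> m" and least: "\<And>i. i < m \<Longrightarrow> \<not> misplaced \<pi> i"
    and k: "k \<in> {m..n}"
  shows "a m \<le> \<bar>signed_val a \<pi> k\<bar>"
proof -
  have m: "m \<in> {1..n}"
    using assms(2) by (simp add: misplaced_def)
  then have k1: "k \<in> {1..n}"
    using k by auto
  obtain l where l: "l \<in> {1..n}" "\<bar>signed_val a \<pi> k\<bar> = a l"
    using abs_val_mem[OF \<pi> k1] by auto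
  have "\<not> l < m"
  proof
    assume "l < m"
    then have "\<bar>signed_val a \<pi> l\<bar> = a l"
      using least l by (auto simp: misplaced_def)
    then have "l = k"
      using abs_val_eq_iff[OF \<pi> l(1) k1] l(2) by simp
    then show False
      using \<open>l < m\<close> k by simp
  qed
  then show ?thesis
    using l m less_iff[of l m] by auto
qed

text \<open>The statement is symmetric in the two neighbouring positions, so that it serves descents
  and ascents alike.\<close>

lemma flip_comp_less_iff:
  assumes \<pi>: "\<pi> \<in> signed_perms n a" and mis: "misplaced \<pi> m"
    and least: "\<And>i. i < m \<Longrightarrow> \<not> misplaced \<pi> i"
    and kl: "k \<le> n" "l \<le> n" "k = Suc l \<or> l = Suc k"
  shows "signed_val a (flip (a m) \<circ> \<pi>) k < signed_val a (flip (a m) \<circ> \<pi>) l \<longleftrightarrow>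
    signed_val a \<pi> k < signed_val a \<pi> l"
proof -
  define w where "w = signed_val a \<pi>"
  have m: "m \<in> {1..n}" and wm: "\<bar>w m\<bar> \<noteq> a m"
    using mis by (auto simp: misplaced_def w_def)
  \<comment> \<open>A position before \<open>m\<close> other than 0 carries its own letter, position
    0 has value 0, and \<open>m\<close> itself is misplaced.\<close>
  have right: "m < p" if p: "p \<le> n" "\<bar>w p\<bar> = a m" for p
  proof (rule ccontr)
    assume "\<not> m < p"
    moreover have "p \<noteq> m"
      using wm p by auto
    moreover have "p \<noteq> 0"
      using p pos[OF m] by (intro notI) (simp add: w_def)
    ultimately have "p < m" "p \<in> {1..n}"
      using p by auto
    then have "\<bar>w p\<bar> = a p"
      using least by (auto simp: misplaced_def w_def)
    then show False
      using p \<open>p < m\<close> \<open>p \<in> {1..n}\<close> m eq_iff by auto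
  qed
  \<comment> \<open>From \<open>m < p\<close> a neighbour \<open>q\<close> satisfies
    \<open>q \<ge> m \<ge> 1\<close>; hence it is not position 0, and its value is at least
    \<open>a m\<close> in absolute value, strictly so since \<open>q \<noteq> p\<close>.\<close>
  have nb: "\<bar>w q\<bar> > a m" if p: "p \<le> n" "\<bar>w p\<bar> = a m" and q: "q \<le> n" "p = Suc q \<or> q = Suc p" for p q
  proof -
    have "m < p"
      using right p by simp
    then have "p \<in> {1..n}" "q \<in> {1..n}" "q \<in> {m..n}" "p \<noteq> q"
      using p q m by auto
    then have "\<bar>w p\<bar> \<noteq> \<bar>w q\<bar>" "a m \<le> \<bar>w q\<bar>"
      using abs_val_eq_iff[OF \<pi>] abs_val_ge_misplaced[OF \<pi> mis least] by (auto simp: w_def)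
    then show ?thesis
      using p by simp
  qed
  have "flip (a m) (w k) < flip (a m) (w l) \<longleftrightarrow> w k < w l"
    by (rule flip_less_flip_iff) (use nb[of k l] nb[of l k] kl in auto)
  then show ?thesis
    by (simp add: signed_val_flip_comp[OF pos[OF m]] w_def)
qed

section \<open>The involution and the cancellation it yields\<close>

definition flip_misplaced :: "(int \<Rightarrow> int) \<Rightarrow> int \<Rightarrow> int" where
  "flip_misplaced \<pi> = flip (a (LEAST i. misplaced \<pi> i)) \<circ> \<pi>"

text \<open>Being misplaced depends on absolute values only. Hence a second application of
  \<open>flip_misplaced\<close> chooses the same letter and undoes the first.\<close>

lemma misplaced_flip_comp:
  assumes "c > 0"
  shows "misplaced (flip c \<circ> \<pi>) = misplaced \<pi>"
  by (simp add: misplaced_def fun_eq_iff signed_val_flip_comp[OF assms])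

lemma sum_misplaced:
  fixes s t u :: "'r::comm_ring_1"
  shows "(\<Sum>\<pi>\<in>{\<pi> \<in> signed_perms n a. \<exists>i. misplaced \<pi> i}. (- 1) ^ inv_B n a \<pi> *
    (t ^ des_B n a \<pi> * s ^ asc_B n a \<pi> * u ^ pos_last n a \<pi>)) = 0"
proof (rule sum_sign_reversing_involution[where \<phi> = flip_misplaced])
  show "finite {\<pi> \<in> signed_perms n a. \<exists>i. misplaced \<pi> i}"
    using finite_signed_perms by simp
next
  fix \<pi> assume "\<pi> \<in> {\<pi> \<in> signed_perms n a. \<exists>i. misplaced \<pi> i}"
  then have \<pi>: "\<pi> \<in> signed_perms n a" and ex: "\<exists>i. misplaced \<pi> i"
    by auto
  define m where "m = (LEAST i. misplaced \<pi> i)"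
  have mis: "misplaced \<pi> m"
    using ex by (auto simp: m_def intro: LeastI)
  have least: "\<And>i. i < m \<Longrightarrow> \<not> misplaced \<pi> i"
    by (auto simp: m_def dest: not_less_Least)
  have m: "m \<in> {1..n}"
    using mis by (simp add: misplaced_def)
  have \<phi>: "flip_misplaced \<pi> = flip (a m) \<circ> \<pi>"
    by (simp add: flip_misplaced_def m_def)
  have mis\<phi>: "misplaced (flip_misplaced \<pi>) = misplaced \<pi>"
    by (simp add: \<phi> misplaced_flip_comp[OF pos[OF m]])
  show "flip_misplaced \<pi> \<in> {\<pi> \<in> signed_perms n a. \<exists>i. misplaced \<pi> i}"
    using ex mis\<phi> flip_comp_signed_perms[OF \<pi>] m by (auto simp: \<phi>)
  show "flip_misplaced (flip_misplaced \<pi>) = \<pi>"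
    by (simp add: flip_misplaced_def[of "flip_misplaced \<pi>"] mis\<phi> flip: m_def)
      (simp add: \<phi> fun_eq_iff)
  show "even (inv_B n a (flip_misplaced \<pi>)) \<longleftrightarrow> odd (inv_B n a \<pi>)"
    unfolding \<phi> by (rule inv_B_flip_comp[OF \<pi> m])
  \<comment> \<open>Used with the pair \<open>i + 1\<close>, \<open>i\<close> for descents and with
    \<open>i\<close>, \<open>i + 1\<close> for ascents.\<close>
  note less = flip_comp_less_iff[OF \<pi> mis least]
  have "des_B n a (flip_misplaced \<pi>) = des_B n a \<pi>" "asc_B n a (flip_misplaced \<pi>) = asc_B n a \<pi>"
    unfolding des_B_def asc_B_def \<phi>
    by (intro arg_cong[where f = card] Collect_cong conj_cong refl less; simp)+
  moreover have "pos_last n a (flip_misplaced \<pi>) = pos_last n a \<pi>"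
    unfolding \<phi> by (rule pos_last_flip_comp[OF pos[OF m]])
  ultimately show "t ^ des_B n a (flip_misplaced \<pi>) * s ^ asc_B n a (flip_misplaced \<pi>) *
      u ^ pos_last n a (flip_misplaced \<pi>) =
    t ^ des_B n a \<pi> * s ^ asc_B n a \<pi> * u ^ pos_last n a \<pi>"
    by simp
qed

section \<open>The signed identities and their statistics\<close>

text \<open>\<open>N\<close> holds positions, not letters. Testing \<bar>x\<bar> makes the map odd
  and its own inverse, and for \<open>N \<subseteq> {1..n}\<close> it fixes everything outside the
  alphabet, as \<open>permutes\<close> demands.\<close>

definition signed_id :: "nat set \<Rightarrow> int \<Rightarrow> int" where
  "signed_id N x = (if \<bar>x\<bar> \<in> a ` N then - x else x)"

lemma signed_id_signed_perms:
  assumes "N \<subseteq> {1..n}"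
  shows "signed_id N \<in> signed_perms n a"
proof -
  have "signed_id N permutes signed_letters n a"
  proof (rule bij_imp_permutes)
    show "bij_betw (signed_id N) (signed_letters n a) (signed_letters n a)"
      by (rule bij_betw_byWitness[where f' = "signed_id N"])
        (auto simp: signed_letters_iff signed_id_def)
  qed (use assms in \<open>auto simp: signed_id_def signed_letters_iff\<close>)
  then show ?thesis
    by (simp add: signed_perms_def signed_id_def)
qed

lemma signed_val_signed_id:
  assumes "N \<subseteq> {1..n}" "i \<in> {1..n}"
  shows "signed_val a (signed_id N) i = (if i \<in> N then - a i else a i)"
proof -
  have "a i \<in> a ` N \<longleftrightarrow> i \<in> N"
    using assms eq_iff by (auto simp: subset_iff)
  then show ?thesis
    using assms pos[of i] by (auto simp: signed_val_def signed_id_def)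
qed

lemma not_misplaced_signed_id:
  assumes "N \<subseteq> {1..n}"
  shows "\<not> misplaced (signed_id N) i"
  using pos[of i] by (auto simp: misplaced_def signed_val_signed_id[OF assms])

lemma negative_signed_id:
  assumes "N \<subseteq> {1..n}"
  shows "{i \<in> {1..n}. signed_val a (signed_id N) i < 0} = N"
proof -
  have "signed_val a (signed_id N) i < 0 \<longleftrightarrow> i \<in> N" if "i \<in> {1..n}" for i
    using signed_val_signed_id[OF assms that] pos[OF that] by simp
  then show ?thesis
    using assms by blast
qed

text \<open>Without misplaced positions, \<open>\<pi> (a i)\<close> is \<open>a i\<close> or
  \<open>- a i\<close>, so the signs determine \<open>\<pi>\<close>: on negative letters by oddness,
  outside the alphabet by \<open>permutes\<close>.\<close>

lemma signed_id_negative: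
  assumes \<pi>: "\<pi> \<in> signed_perms n a" and no: "\<And>i. \<not> misplaced \<pi> i"
  shows "signed_id {i \<in> {1..n}. signed_val a \<pi> i < 0} = \<pi>"
proof
  fix x
  let ?N = "{i \<in> {1..n}. signed_val a \<pi> i < 0}"
  show "signed_id ?N x = \<pi> x"
  proof (cases "x \<in> signed_letters n a")
    case False
    then have "\<bar>x\<bar> \<notin> a ` ?N" "\<pi> x = x"
      using signed_permsD(1)[OF \<pi>] by (auto simp: signed_letters_iff permutes_not_in)
    then show ?thesis
      by (simp add: signed_id_def)
  next
    case True
    then obtain i where i: "i \<in> {1..n}" "\<bar>x\<bar> = a i"
      by (auto simp: signed_letters_iff)
    have ai: "a i \<in> signed_letters n a"
      using i by (auto simp: signed_letters_def)
    have abs: "\<bar>\<pi> (a i)\<bar> = a i"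
      using no[of i] i by (auto simp: misplaced_def signed_val_def)
    have "a i \<in> a ` ?N \<longleftrightarrow> i \<in> ?N"
      using i eq_iff by auto
    then have "signed_id ?N (a i) = \<pi> (a i)"
      using i abs pos[OF i(1)] by (auto simp: signed_id_def signed_val_def)
    moreover have "signed_id ?N (- a i) = - signed_id ?N (a i)"
      by (simp add: signed_id_def)
    moreover have "x = a i \<or> x = - a i"
      using i(2) by linarith
    ultimately show ?thesis
      using signed_permsD(2)[OF \<pi> ai] by metis
  qed
qed

text \<open>Absolute values strictly increase, starting from the value 0 at position 0, so the sign
  of the right-hand letter decides each step.\<close>

lemma signed_id_step:
  assumes N: "N \<subseteq> {1..n}" and i: "i < n"
  shows "signed_val a (signed_id N) i > signed_val a (signed_id N) (i + 1) \<longleftrightarrow> Suc i \<in> N"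
    and "signed_val a (signed_id N) i < signed_val a (signed_id N) (i + 1) \<longleftrightarrow> Suc i \<notin> N"
proof -
  have p: "a (Suc i) > 0"
    using i pos by simp
  have "\<bar>signed_val a (signed_id N) i\<bar> < a (Suc i)"
  proof (cases "i = 0")
    case False
    then show ?thesis
      using i pos[of i] less_iff[of i "Suc i"] by (simp add: signed_val_signed_id[OF N])
  qed (use p in simp)
  then show "signed_val a (signed_id N) i > signed_val a (signed_id N) (i + 1) \<longleftrightarrow> Suc i \<in> N"
    "signed_val a (signed_id N) i < signed_val a (signed_id N) (i + 1) \<longleftrightarrow> Suc i \<notin> N"
    using i by (auto simp: signed_val_signed_id[OF N])
qed

lemma des_B_signed_id:
  assumes N: "N \<subseteq> {1..n}"
  shows "des_B n a (signed_id N) = card N"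
proof -
  \<comment> \<open>Descents are indexed by the left end of a step, \<open>N\<close> by the right
    end; \<open>Suc\<close> translates.\<close>
  have "Suc ` {i \<in> {0..<n}. Suc i \<in> N} = {i \<in> Suc ` {0..<n}. i \<in> N}"
    by blast
  also have "\<dots> = N"
    using N by (auto simp: image_Suc_atLeastLessThan)
  finally have "bij_betw Suc {i \<in> {0..<n}. Suc i \<in> N} N"
    by (simp add: bij_betw_def)
  moreover have "{i \<in> {0..<n}. signed_val a (signed_id N) i > signed_val a (signed_id N) (i + 1)}
      = {i \<in> {0..<n}. Suc i \<in> N}"
    using signed_id_step[OF N] by auto
  ultimately show ?thesis
    unfolding des_B_def by (metis bij_betw_same_card)
qed

lemma asc_B_signed_id:
  assumes N: "N \<subseteq> {1..n}"
  shows "asc_B n a (signed_id N) = n - card N"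
proof -
  have "Suc ` {i \<in> {0..<n}. Suc i \<notin> N} = Suc ` {0..<n} - N"
    by blast
  then have "bij_betw Suc {i \<in> {0..<n}. Suc i \<notin> N} ({1..n} - N)"
    by (simp add: bij_betw_def image_Suc_atLeastLessThan atLeastLessThanSuc_atLeastAtMost)
  moreover have "{i \<in> {0..<n}. signed_val a (signed_id N) i < signed_val a (signed_id N) (i + 1)}
      = {i \<in> {0..<n}. Suc i \<notin> N}"
    using signed_id_step[OF N] by auto
  moreover have "card ({1..n} - N) = n - card N"
    using N by (simp add: card_Diff_subset finite_subset[OF N])
  ultimately show ?thesis
    unfolding asc_B_def by (metis bij_betw_same_card)
qed

lemma pos_last_signed_id:
  assumes N: "N \<subseteq> {1..n}" and "n \<ge> 1"
  shows "pos_last n a (signed_id N) = n"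
proof -
  have "\<bar>signed_val a (signed_id N) k\<bar> = a k" if "k \<in> {1..n}" for k
    using not_misplaced_signed_id[OF N, of k] that by (simp add: misplaced_def)
  then show ?thesis
    unfolding pos_last_def using assms(2) eq_iff by (intro the_equality) auto
qed

text \<open>The absolute values form an increasing word without inversions, which leaves only the
  negative letters to count.\<close>

lemma even_inv_B_signed_id:
  assumes N: "N \<subseteq> {1..n}"
  shows "even (inv_B n a (signed_id N)) \<longleftrightarrow> even (card N)"
proof -
  have "{(i, j). 1 \<le> i \<and> i < j \<and> j \<le> n \<and>
      \<bar>signed_val a (signed_id N) i\<bar> > \<bar>signed_val a (signed_id N) j\<bar>} = {}"
  proof -
    have "\<bar>signed_val a (signed_id N) i\<bar> < \<bar>signed_val a (signed_id N) j\<bar>"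
      if "1 \<le> i" "i < j" "j \<le> n" for i j
      using that not_misplaced_signed_id[OF N, of i] not_misplaced_signed_id[OF N, of j]
        less_iff[of i j] by (simp add: misplaced_def)
    then show ?thesis
      by (auto dest: less_asym)
  qed
  then show ?thesis
    by (simp only: even_inv_B_iff[OF signed_id_signed_perms[OF N]] negative_signed_id[OF N]) simp
qed

section \<open>Evaluation of the surviving sum and conclusion\<close>

lemma sum_not_misplaced:
  fixes s t u :: "'r::comm_ring_1"
  assumes "n \<ge> 1"
  shows "(\<Sum>\<pi>\<in>{\<pi> \<in> signed_perms n a. \<not> (\<exists>i. misplaced \<pi> i)}. (- 1) ^ inv_B n a \<pi> *
    (t ^ des_B n a \<pi> * s ^ asc_B n a \<pi> * u ^ pos_last n a \<pi>)) = (s - t) ^ n * u ^ n"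
    (is "(\<Sum>\<pi>\<in>?T. ?f \<pi>) = _")
proof -
  \<comment> \<open>The survivors correspond bijectively to subsets of \<open>{1..n}\<close> through
    their sets of negative positions.\<close>
  have "(\<Sum>\<pi>\<in>?T. ?f \<pi>) = (\<Sum>N\<in>Pow {1..n}. ?f (signed_id N))"
  proof (rule sum.reindex_bij_witness[where i = signed_id
        and j = "\<lambda>\<pi>. {i \<in> {1..n}. signed_val a \<pi> i < 0}"])
    fix \<pi> assume "\<pi> \<in> ?T"
    then show id: "signed_id {i \<in> {1..n}. signed_val a \<pi> i < 0} = \<pi>"
      by (intro signed_id_negative) blast+
    show "{i \<in> {1..n}. signed_val a \<pi> i < 0} \<in> Pow {1..n}"
      by blast
    show "?f (signed_id {i \<in> {1..n}. signed_val a \<pi> i < 0}) = ?f \<pi>"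
      by (simp only: id)
  next
    fix N assume "N \<in> Pow {1..n}"
    then have N: "N \<subseteq> {1..n}"
      by simp
    show "{i \<in> {1..n}. signed_val a (signed_id N) i < 0} = N"
      by (rule negative_signed_id[OF N])
    show "signed_id N \<in> ?T"
      using signed_id_signed_perms[OF N] not_misplaced_signed_id[OF N] by blast
  qed
  also have "\<dots> = (\<Sum>N\<in>Pow {1..n}. (- t) ^ card N * s ^ (card {1..n} - card N) * u ^ n)"
  proof (rule sum.cong)
    fix N assume "N \<in> Pow {1..n}"
    then have N: "N \<subseteq> {1..n}"
      by simp
    \<comment> \<open>One sign per negative letter, hence per descent, turns \<open>t\<close> into
      \<open>- t\<close>.\<close>
    have "(- 1 :: 'r) ^ inv_B n a (signed_id N) = (- 1) ^ card N"
      using even_inv_B_signed_id[OF N] by (simp add: minus_one_power_iff)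
    then show "?f (signed_id N) = (- t) ^ card N * s ^ (card {1..n} - card N) * u ^ n"
      using power_minus[of t "card N"]
      by (simp add: des_B_signed_id[OF N] asc_B_signed_id[OF N] pos_last_signed_id[OF N assms]
          mult.assoc)
  qed simp
  also have "\<dots> = (- t + s) ^ card {1..n} * u ^ n"
    by (simp only: sum_Pow_binomial[OF finite_atLeastAtMost] flip: sum_distrib_right)
  finally show ?thesis
    by simp
qed

end

theorem theorem20:
  fixes n :: nat and a :: "nat \<Rightarrow> int" and s t u :: "'r::comm_ring_1"
  assumes "n \<ge> 1"
    and "\<And>i. i \<in> {1..n} \<Longrightarrow> a i > 0"
    and "strict_mono_on {1..n} a"
  shows "(\<Sum>\<pi>\<in>signed_perms n a.
            (- 1) ^ inv_B n a \<pi> * t ^ des_B n a \<pi> * s ^ asc_B n a \<pi> * u ^ pos_last n a \<pi>)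
         = (s - t) ^ n * u ^ n"
proof -
  interpret signed_alphabet n a
    using assms by unfold_locales
  \<comment> \<open>Bracketed as sign times weight, the shape required for the cancellation;
    associativity restores the stated form at the end.\<close>
  let ?f = "\<lambda>\<pi>. (- 1) ^ inv_B n a \<pi> * (t ^ des_B n a \<pi> * s ^ asc_B n a \<pi> * u ^ pos_last n a \<pi>)"
  let ?T = "{\<pi> \<in> signed_perms n a. \<exists>i. misplaced \<pi> i}"
  let ?R = "{\<pi> \<in> signed_perms n a. \<not> (\<exists>i. misplaced \<pi> i)}"
  have "(\<Sum>\<pi>\<in>signed_perms n a. ?f \<pi>) = (\<Sum>\<pi>\<in>?T \<union> ?R. ?f \<pi>)"
    by (rule sum.cong) auto
  also have "\<dots> = (\<Sum>\<pi>\<in>?T. ?f \<pi>) + (\<Sum>\<pi>\<in>?R. ?f \<pi>)"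
    by (rule sum.union_disjoint) (use finite_signed_perms in auto)
  also have "\<dots> = (s - t) ^ n * u ^ n"
    by (simp only: sum_misplaced sum_not_misplaced[OF assms(1)] add_0)
  finally show ?thesis
    by (simp only: mult.assoc)
qed

end
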